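(* Let $d\ge1$, $1\le m<n$ be integers, $\alpha\in(0,1)$, and let $U_1,\dots,U_n$ be i.i.d. standard $d$-dimensional Gaussian vectors (mean $\mathbf 0$, identity covariance). For $\theta\in\mathbb R^d$ let $X_i=U_i+\theta$, $1\le i\le n$, and let $P_\theta$ be the law of $(X_1,\dots,X_n)$ on $(\mathbb R^d)^n$. Consider testing $H:\theta=\mathbf 0$ versus $K:\theta\in\mathbb R^d\setminus\{\mathbf 0\}$ at level $\alpha$. Let $\phi=\mathbf 1_{R_\phi}$ be the test with rejection zone $$R_\phi=\left\{(x_1,\dots,x_n)\in(\mathbb R^d)^n:\ \bar x_1\ne\mathbf 0,\ \frac{\bar x_1\cdot\bar x_2}{\|\bar x_1\|}>D\right\},$$ where $\bar x_1=\frac1m\sum_{i=1}^m x_i$, $\bar x_2=\frac1{n-m}\sum_{i=m+1}^n x_i$, and $D>0$ is the constant, determined by $(\alpha,n,m)$, for which $P_{\mathbf 0}(R_\phi)=\alpha$. Then $\phi\in\Phi_0(\alpha)\setminus\mathcal A_0(\alpha)$; that is, $\phi$ is a regular test of level $\alpha$ which is inadmissible within the class of regular tests of level $\alpha$.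
   Context: $\cdot$ is the dot product and $\|\cdot\|$ the Euclidean norm in $\mathbb R^d$. Here $\Theta=\mathbb R^d$, $\Theta_K=\mathbb R^d\setminus\{\mathbf 0\}$, and the sample space is $\mathcal X=(\mathbb R^d)^n$. A test is a Borel function $\phi:\mathcal X\to[0,1]$. Its power function is $\beta_\phi(\theta)=\int_{\mathcal X}\phi\,dP_\theta$, $\theta\in\Theta$, and $\gamma_\phi=1-\beta_\phi$. $\mathcal C_0(\Theta)$ is the set of continuous $f:\Theta\to\mathbb R$ such that for every $\epsilon>0$ the set $\{|f|\ge\epsilon\}$ is contained in a compact subset of $\Theta$. $\Phi(\alpha)$ is the set of tests $\phi$ with $\beta_\phi(\mathbf 0)=\alpha$, and $\Phi_0(\alpha)=\{\phi\in\Phi(\alpha):\gamma_\phi\in\mathcal C_0(\Theta)\}$ (regular tests of level $\alpha$). A test $\phi\in\Phi_0(\alpha)$ is admissible in $\Phi_0(\alpha)$ iff for every $\phi'\in\Phi_0(\alpha)$, $\beta_\phi(\theta)\le\beta_{\phi'}(\theta)$ for all $\theta\in\Theta_K$ implies $\beta_\phi(\theta)=\beta_{\phi'}(\theta)$ for all $\theta\in\Theta_K$. $\mathcal A_0(\alpha)$ is the set of tests admissible in $\Phi_0(\alpha)$. *)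

theory Defs
  imports "HOL-Probability.Probability"
begin

definition std_gaussian_density :: "real ^ 'd \<Rightarrow> real" where
  "std_gaussian_density x = exp (- (norm x)\<^sup>2 / 2) / sqrt (2 * pi) ^ CARD('d)"

text \<open>The sample space carries the product sigma-algebra, which is the Borel sigma-algebra of the
  finite power of the second-countable space; points are extensional functions on the indices
  from 1 to n.\<close>

definition sample_space :: "nat \<Rightarrow> (nat \<Rightarrow> real ^ 'd) measure" where
  "sample_space n = (\<Pi>\<^sub>M i\<in>{1..n}. borel)"

definition shifted_law ::
    "'w measure \<Rightarrow> (nat \<Rightarrow> 'w \<Rightarrow> real ^ 'd) \<Rightarrow> nat \<Rightarrow> real ^ 'd \<Rightarrow> (nat \<Rightarrow> real ^ 'd) measure" where
  "shifted_law M U n \<theta> = distr M (sample_space n) (\<lambda>\<omega>. \<lambda>i\<in>{1..n}. U i \<omega> + \<theta>)"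

text \<open>In the following, \<open>S\<close> is the sample space and \<open>P\<close> the family of laws on it, whose parameter
  set is the whole type. The null hypothesis is the single parameter 0.\<close>

definition tests :: "'x measure \<Rightarrow> ('x \<Rightarrow> real) set" where
  "tests S = {\<phi> \<in> borel_measurable S. \<forall>x\<in>space S. 0 \<le> \<phi> x \<and> \<phi> x \<le> 1}"

definition test_power :: "('p \<Rightarrow> 'x measure) \<Rightarrow> ('x \<Rightarrow> real) \<Rightarrow> 'p \<Rightarrow> real" where
  "test_power P \<phi> \<theta> = (\<integral>x. \<phi> x \<partial>(P \<theta>))"

definition continuous_vanishing :: "('p::topological_space \<Rightarrow> real) set" where
  "continuous_vanishing =
    {f. continuous_on UNIV f \<and> (\<forall>\<epsilon>>0. \<exists>K. compact K \<and> {\<theta>. \<bar>f \<theta>\<bar> \<ge> \<epsilon>} \<subseteq> K)}"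

definition level_tests ::
    "'x measure \<Rightarrow> ('p::zero \<Rightarrow> 'x measure) \<Rightarrow> real \<Rightarrow> ('x \<Rightarrow> real) set" where
  "level_tests S P \<alpha> = {\<phi> \<in> tests S. test_power P \<phi> 0 = \<alpha>}"

definition regular_tests ::
    "'x measure \<Rightarrow> ('p::{zero,topological_space} \<Rightarrow> 'x measure) \<Rightarrow> real \<Rightarrow> ('x \<Rightarrow> real) set" where
  "regular_tests S P \<alpha> =
    {\<phi> \<in> level_tests S P \<alpha>. (\<lambda>\<theta>. 1 - test_power P \<phi> \<theta>) \<in> continuous_vanishing}"

definition admissible_tests ::
    "'x measure \<Rightarrow> ('p::{zero,topological_space} \<Rightarrow> 'x measure) \<Rightarrow> real \<Rightarrow> ('x \<Rightarrow> real) set" where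
  "admissible_tests S P \<alpha> =
    {\<phi> \<in> regular_tests S P \<alpha>. \<forall>\<phi>' \<in> regular_tests S P \<alpha>.
       (\<forall>\<theta>. \<theta> \<noteq> 0 \<longrightarrow> test_power P \<phi> \<theta> \<le> test_power P \<phi>' \<theta>) \<longrightarrow>
       (\<forall>\<theta>. \<theta> \<noteq> 0 \<longrightarrow> test_power P \<phi> \<theta> = test_power P \<phi>' \<theta>)}"

definition first_mean :: "nat \<Rightarrow> (nat \<Rightarrow> real ^ 'd) \<Rightarrow> real ^ 'd" where
  "first_mean m x = (1 / real m) *\<^sub>R (\<Sum>i\<in>{1..m}. x i)"

definition second_mean :: "nat \<Rightarrow> nat \<Rightarrow> (nat \<Rightarrow> real ^ 'd) \<Rightarrow> real ^ 'd" where
  "second_mean m n x = (1 / real (n - m)) *\<^sub>R (\<Sum>i\<in>{m+1..n}. x i)"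

definition rejection_zone :: "nat \<Rightarrow> nat \<Rightarrow> real \<Rightarrow> (nat \<Rightarrow> real ^ 'd) set" where
  "rejection_zone m n D =
    {x \<in> space (sample_space n). first_mean m x \<noteq> 0 \<and>
       (first_mean m x \<bullet> second_mean m n x) / norm (first_mean m x) > D}"

end

theory Submission
  imports Defs
begin

text \<open>Let \<open>S\<close> be the sum of the observations. The likelihood ratio of the law at \<open>\<theta>\<close> against the law
  at 0 depends on the sample only through \<open>S\<close>. The rejection zone is invariant under simultaneous
  rotations of the observations, so the power of its test is constant on spheres and may be computed
  from the likelihood ratio averaged over a sphere, which is a strictly increasing function of the
  norm of \<open>S\<close>. By the Neyman--Pearson argument, the test of the same level that rejects for large
  \<open>norm S\<close> (randomised on the boundary) is at least as powerful everywhere, and strictly more powerful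
  since the given test accepts on a non-null set where \<open>norm S\<close> is large. Power functions are
  continuous by Scheffe's lemma, and both tests have power tending to 1 at infinity because every
  fixed noise sample is eventually rejected as \<open>\<theta>\<close> tends to infinity.\<close>

section \<open>The standard Gaussian measure\<close>

definition std_gaussian :: "(real ^ 'd) measure" where
  "std_gaussian = density lborel (\<lambda>x. ennreal (std_gaussian_density x))"

lemma borel_measurable_std_gaussian_density [measurable]:
  "std_gaussian_density \<in> borel_measurable borel"
  unfolding std_gaussian_density_def by measurable

lemma std_gaussian_density_pos: "0 < std_gaussian_density x"
  by (simp add: std_gaussian_density_def)

lemma sets_std_gaussian [measurable_cong, simp]: "sets std_gaussian = sets borel"
  by (simp add: std_gaussian_def)

lemma space_std_gaussian [simp]: "space std_gaussian = UNIV"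
  by (simp add: std_gaussian_def)

text \<open>The squared norm is the sum of the squared coordinates and \<open>exp\<close> turns sums
  into products. This reduces the total mass of the density to dimension one.\<close>

lemma std_gaussian_density_eq_prod:
  fixes x :: "real ^ 'd"
  shows "std_gaussian_density x = (\<Prod>b\<in>Basis. std_normal_density (x \<bullet> b))"
proof -
  have "(\<Prod>b\<in>Basis. std_normal_density (x \<bullet> b))
      = (1 / sqrt (2 * pi)) ^ CARD('d) * exp (\<Sum>b\<in>Basis. - (x \<bullet> b)\<^sup>2 / 2)"
    unfolding std_normal_density_def prod.distrib by (simp add: exp_sum)
  also have "(\<Sum>b\<in>Basis. - (x \<bullet> b)\<^sup>2 / 2) = - (norm x)\<^sup>2 / 2"
    by (simp add: norm_eq_sqrt_inner euclidean_inner[of x x] power2_eq_square sum_nonneg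
        sum_negf flip: sum_divide_distrib)
  finally show ?thesis
    by (simp add: std_gaussian_density_def power_divide)
qed

lemma prob_space_std_gaussian: "prob_space (std_gaussian :: (real ^ 'd) measure)"
proof
  have "emeasure std_gaussian (space (std_gaussian :: (real ^ 'd) measure))
      = (\<integral>\<^sup>+x. ennreal (std_gaussian_density (x :: real ^ 'd)) \<partial>lborel)"
    by (simp add: std_gaussian_def emeasure_density)
  also have "\<dots> = (\<integral>\<^sup>+(x :: real ^ 'd). (\<Prod>b\<in>Basis. ennreal (std_normal_density (x \<bullet> b))) \<partial>lborel)"
    by (simp add: std_gaussian_density_eq_prod prod_ennreal)
  also have "\<dots> = (\<Prod>b\<in>(Basis :: (real ^ 'd) set). \<integral>\<^sup>+x. ennreal (std_normal_density x) \<partial>lborel)"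
    by (rule nn_integral_lborel_prod) auto
  also have "(\<integral>\<^sup>+x. ennreal (std_normal_density x) \<partial>lborel) = 1"
    by (subst nn_integral_eq_integral) auto
  finally show "emeasure std_gaussian (space (std_gaussian :: (real ^ 'd) measure)) = 1"
    by simp
qed

section \<open>Orthogonal maps and translations acting on the Gaussian measure\<close>

lemma orthogonal_transformation_measurable:
  fixes f :: "'a::euclidean_space \<Rightarrow> 'a"
  assumes "orthogonal_transformation f"
  shows "f \<in> borel_measurable borel"
  using orthogonal_transformation_linear[OF assms]
  by (intro borel_measurable_continuous_onI linear_continuous_on) (simp add: linear_conv_bounded_linear)

text \<open>Uniqueness of Haar measure by Fubini: a translation invariant measure is a multiple of the
  Lebesgue measure, and the unit ball fixes the factor.\<close>

lemma distr_lborel_orthogonal: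
  fixes f :: "'a::euclidean_space \<Rightarrow> 'a"
  assumes f: "orthogonal_transformation f"
  shows "distr lborel borel f = lborel"
proof -
  define \<nu> where "\<nu> = distr lborel borel f"
  have "linear f" using f by (rule orthogonal_transformation_linear)
  have [measurable]: "f \<in> borel_measurable borel" using f by (rule orthogonal_transformation_measurable)
  have sets_\<nu> [measurable_cong]: "sets \<nu> = sets borel" by (simp add: \<nu>_def)
  have ball: "emeasure \<nu> (ball 0 1) = emeasure lborel (ball (0::'a) 1)"
  proof -
    have "f -` ball 0 1 = ball 0 1"
      using f by (auto simp: orthogonal_transformation)
    then show ?thesis by (simp add: \<nu>_def emeasure_distr)
  qed
  \<comment> \<open>As \<open>f\<close> is linear and onto, translating its image by
    \<open>y\<close> amounts to translating its argument by \<open>inv f y\<close>, which Lebesgue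
    measure does not see.\<close>
  have transl: "(\<integral>\<^sup>+x. h (x + y) \<partial>\<nu>) = (\<integral>\<^sup>+x. h x \<partial>\<nu>)" if [measurable]: "h \<in> borel_measurable borel"
    for h and y :: 'a
  proof -
    have "(\<integral>\<^sup>+x. h (x + y) \<partial>\<nu>) = (\<integral>\<^sup>+x. h (f (inv f y + x)) \<partial>lborel)"
      using f \<open>linear f\<close> by (simp add: \<nu>_def nn_integral_distr linear_add add.commute
          surj_f_inv_f orthogonal_transformation_surj)
    also have "\<dots> = (\<integral>\<^sup>+x. h (f x) \<partial>distr lborel borel ((+) (inv f y)))"
      by (subst nn_integral_distr) auto
    also have "\<dots> = (\<integral>\<^sup>+x. h x \<partial>\<nu>)"
      by (simp add: lborel_distr_plus \<nu>_def nn_integral_distr)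
    finally show ?thesis .
  qed
  have transl_lborel: "(\<integral>\<^sup>+x. h (y + x) \<partial>lborel) = (\<integral>\<^sup>+x. h x \<partial>lborel)"
    if [measurable]: "h \<in> borel_measurable borel" for h and y :: 'a
    by (subst (2) lborel_distr_plus[of y, symmetric], subst nn_integral_distr) auto
  have refl_lborel: "(\<integral>\<^sup>+x. h (- x) \<partial>lborel) = (\<integral>\<^sup>+x. h x \<partial>lborel)"
    if [measurable]: "h \<in> borel_measurable borel" for h :: "'a \<Rightarrow> ennreal"
    by (subst (2) lborel_affine[of "-1" 0]) (simp_all add: nn_integral_distr nn_integral_density)
  \<comment> \<open>Fubini asks for a sigma-finite \<open>\<nu>\<close>; the property is pulled back
    from Lebesgue measure, which is the image of \<open>\<nu>\<close> under
    \<open>inv f\<close>.\<close>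
  interpret \<nu>: sigma_finite_measure \<nu>
  proof -
    have "inv f (f x) = x" for x
      using f by (simp add: orthogonal_transformation_inj)
    moreover have [measurable]: "inv f \<in> borel_measurable borel"
      by (intro orthogonal_transformation_measurable orthogonal_transformation_inv f)
    ultimately have "distr \<nu> borel (inv f) = lborel"
      by (simp add: \<nu>_def distr_distr comp_def distr_id2)
    then show "sigma_finite_measure \<nu>"
      by (intro sigma_finite_measure_distr[of \<nu> borel "inv f"]) (simp_all add: lborel.sigma_finite_measure_axioms)
  qed
  interpret pair_sigma_finite \<nu> "lborel :: 'a measure" ..
  have "emeasure lborel A = emeasure \<nu> A" if [measurable]: "A \<in> sets borel" for A
  proof -
    define B where "B = ball (0::'a) 1"
    have [measurable]: "B \<in> sets borel" by (simp add: B_def)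
    \<comment> \<open>One double integral is evaluated in two ways. Integrating over
      \<open>y\<close> directly gives this product. If \<open>x\<close> is first translated by
      \<open>- y\<close> under \<open>\<nu>\<close>, the integral over \<open>y\<close> produces the
      Lebesgue measure of \<open>A\<close> and leaves the \<open>\<nu>\<close>-measure of the ball,
      which is its volume.\<close>
    have "emeasure \<nu> A * emeasure lborel B = (\<integral>\<^sup>+x. \<integral>\<^sup>+y. indicator A x * indicator B (x + y) \<partial>lborel \<partial>\<nu>)"
      by (simp add: nn_integral_cmult transl_lborel[of "indicator B"] nn_integral_multc)
    also have "\<dots> = (\<integral>\<^sup>+y. \<integral>\<^sup>+x. indicator A x * indicator B (x + y) \<partial>\<nu> \<partial>lborel)"
      by (rule Fubini'[symmetric]) measurable
    also have "\<dots> = (\<integral>\<^sup>+y. \<integral>\<^sup>+x. indicator A (x - y) * indicator B x \<partial>\<nu> \<partial>lborel)"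
      using transl[of "\<lambda>x. indicator A (x - y) * indicator B x" y for y] by simp
    also have "\<dots> = (\<integral>\<^sup>+x. \<integral>\<^sup>+y. indicator A (x - y) * indicator B x \<partial>lborel \<partial>\<nu>)"
      by (rule Fubini') measurable
    also have "(\<lambda>x. \<integral>\<^sup>+y. indicator A (x - y) * indicator B x \<partial>lborel)
        = (\<lambda>x. emeasure lborel A * indicator B x)"
      using refl_lborel[of "\<lambda>y. indicator A (x + y)" for x] transl_lborel[of "indicator A"]
      by (simp add: nn_integral_multc fun_eq_iff)
    also have "(\<integral>\<^sup>+x. emeasure lborel A * indicator B x \<partial>\<nu>) = emeasure lborel A * emeasure lborel B"
      by (subst nn_integral_cmult_indicator) (simp_all add: sets_\<nu> B_def ball)
    moreover have "\<not> unit_ball_vol (real DIM('a)) \<le> 0" by (simp add: not_le)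
    ultimately show ?thesis
      by (simp add: B_def emeasure_ball mult_right_ennreal_cancel)
  qed
  then show ?thesis
    by (intro measure_eqI) (auto simp: \<nu>_def)
qed

text \<open>The density depends on the point only through its norm, and \<open>f\<close> preserves
  both the norm and Lebesgue measure.\<close>

lemma distr_std_gaussian_orthogonal:
  fixes f :: "real ^ 'd \<Rightarrow> real ^ 'd"
  assumes f: "orthogonal_transformation f"
  shows "distr std_gaussian borel f = std_gaussian"
proof (rule measure_eqI)
  note [measurable] = orthogonal_transformation_measurable[OF f]
  fix A :: "(real ^ 'd) set" assume "A \<in> sets (distr std_gaussian borel f)"
  then have [measurable]: "A \<in> sets borel" by simp
  have dens: "std_gaussian_density (f x) = std_gaussian_density x" for x
    using f by (simp add: std_gaussian_density_def orthogonal_transformation)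
  have "emeasure (distr std_gaussian borel f) A
     = (\<integral>\<^sup>+x. ennreal (std_gaussian_density x) * indicator (f -` A) x \<partial>lborel)"
    using measurable_sets_borel[of f borel A]
    by (simp add: emeasure_distr std_gaussian_def emeasure_density)
  also have "\<dots> = (\<integral>\<^sup>+x. ennreal (std_gaussian_density (f x)) * indicator A (f x) \<partial>lborel)"
    by (simp add: dens indicator_def vimage_def)
  also have "\<dots> = (\<integral>\<^sup>+x. ennreal (std_gaussian_density x) * indicator A x \<partial>distr lborel borel f)"
    by (subst nn_integral_distr) auto
  finally show "emeasure (distr std_gaussian borel f) A = emeasure std_gaussian A"
    by (simp add: distr_lborel_orthogonal[OF f] std_gaussian_def emeasure_density)
qed simp

text \<open>Completing the square compares the density at \<open>x - \<theta>\<close> with the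
  density at \<open>x\<close>. This is the Cameron-Martin formula in finite dimension.\<close>

lemma distr_std_gaussian_shift:
  fixes \<theta> :: "real ^ 'd"
  shows "distr std_gaussian borel (\<lambda>x. x + \<theta>) =
    density std_gaussian (\<lambda>x. ennreal (exp (\<theta> \<bullet> x - (norm \<theta>)\<^sup>2 / 2)))"
proof (rule measure_eqI)
  fix A :: "(real ^ 'd) set" assume "A \<in> sets (distr std_gaussian borel (\<lambda>x. x + \<theta>))"
  then have [measurable]: "A \<in> sets borel" by simp
  have dens: "std_gaussian_density (x - \<theta>)
      = std_gaussian_density x * exp (\<theta> \<bullet> x - (norm \<theta>)\<^sup>2 / 2)" for x
    by (simp add: std_gaussian_density_def power2_norm_eq_inner inner_diff inner_commute
        diff_divide_distrib add_divide_distrib flip: exp_add)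
  have "emeasure (distr std_gaussian borel (\<lambda>x. x + \<theta>)) A
     = (\<integral>\<^sup>+x. ennreal (std_gaussian_density x) * indicator ((\<lambda>x. x + \<theta>) -` A) x \<partial>lborel)"
    using measurable_sets_borel[of "\<lambda>x. x + \<theta>" borel A]
    by (simp add: emeasure_distr std_gaussian_def emeasure_density)
  also have "\<dots> = (\<integral>\<^sup>+x. ennreal (std_gaussian_density ((\<theta> + x) - \<theta>)) * indicator A (\<theta> + x) \<partial>lborel)"
    by (simp add: indicator_def vimage_def add.commute)
  also have "\<dots> = (\<integral>\<^sup>+x. ennreal (std_gaussian_density (x - \<theta>)) * indicator A x \<partial>distr lborel borel ((+) \<theta>))"
    by (subst nn_integral_distr) auto
  also have "\<dots> = emeasure (density std_gaussian (\<lambda>x. ennreal (exp (\<theta> \<bullet> x - (norm \<theta>)\<^sup>2 / 2)))) A"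
    by (simp add: lborel_distr_plus dens std_gaussian_def density_density_eq emeasure_density ennreal_mult
        std_gaussian_density_pos less_imp_le)
  finally show "emeasure (distr std_gaussian borel (\<lambda>x. x + \<theta>)) A
    = emeasure (density std_gaussian (\<lambda>x. ennreal (exp (\<theta> \<bullet> x - (norm \<theta>)\<^sup>2 / 2)))) A" .
qed simp

text \<open>A product measure is determined by its values on boxes, where the integral of the
  product density factorises over the coordinates.\<close>

lemma PiM_density:
  fixes I :: "'i set"
  assumes "finite I" "product_sigma_finite (\<lambda>_ :: 'i. M)"
    and "product_sigma_finite (\<lambda>_ :: 'i. density M f)"
    and [measurable]: "f \<in> borel_measurable M"
  shows "PiM I (\<lambda>_. density M f) = density (PiM I (\<lambda>_. M)) (\<lambda>x. \<Prod>i\<in>I. f (x i))"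
proof -
  interpret M: product_sigma_finite "\<lambda>_ :: 'i. M" by fact
  interpret N: product_sigma_finite "\<lambda>_ :: 'i. density M f" by fact
  show ?thesis
  proof (rule N.PiM_eqI[symmetric])
    show "sets (density (PiM I (\<lambda>_. M)) (\<lambda>x. \<Prod>i\<in>I. f (x i))) = sets (PiM I (\<lambda>_. density M f))"
      by (simp cong: sets_PiM_cong)
  next
    fix A assume A: "\<And>i. i \<in> I \<Longrightarrow> A i \<in> sets (density M f)"
    have "emeasure (density (PiM I (\<lambda>_. M)) (\<lambda>x. \<Prod>i\<in>I. f (x i))) (Pi\<^sub>E I A)
      = (\<integral>\<^sup>+x. (\<Prod>i\<in>I. f (x i)) * indicator (Pi\<^sub>E I A) x \<partial>PiM I (\<lambda>_. M))"
      using A \<open>finite I\<close> by (subst emeasure_density) (auto intro!: sets_PiM_I_finite)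
    also have "\<dots> = (\<integral>\<^sup>+x. (\<Prod>i\<in>I. f (x i) * indicator (A i) (x i)) \<partial>PiM I (\<lambda>_. M))"
      using \<open>finite I\<close>
      by (intro nn_integral_cong)
        (auto simp: prod.distrib indicator_def space_PiM PiE_iff prod_zero_iff intro!: prod.neutral)
    also have "\<dots> = (\<Prod>i\<in>I. \<integral>\<^sup>+x. f x * indicator (A i) x \<partial>M)"
      using A \<open>finite I\<close> by (subst M.product_nn_integral_prod) auto
    also have "\<dots> = (\<Prod>i\<in>I. emeasure (density M f) (A i))"
      using A by (intro prod.cong) (auto simp: emeasure_density)
    finally show "emeasure (density (PiM I (\<lambda>_. M)) (\<lambda>x. \<Prod>i\<in>I. f (x i))) (Pi\<^sub>E I A)
      = (\<Prod>i\<in>I. emeasure (density M f) (A i))" .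
  qed (rule \<open>finite I\<close>)
qed

section \<open>Gaussian shift laws and power functions\<close>

text \<open>The law of the noise, hence the law under the null hypothesis; it dominates all laws of
  the family. \<open>sample_space\<close> supplies only the sigma-algebra.\<close>

definition gaussian_sample :: "nat \<Rightarrow> (nat \<Rightarrow> real ^ 'd) measure" where
  "gaussian_sample n = (\<Pi>\<^sub>M i\<in>{1..n}. std_gaussian)"

definition translate :: "nat \<Rightarrow> real ^ 'd \<Rightarrow> (nat \<Rightarrow> real ^ 'd) \<Rightarrow> nat \<Rightarrow> real ^ 'd" where
  "translate n \<theta> x = (\<lambda>i\<in>{1..n}. x i + \<theta>)"

definition gaussian_law :: "nat \<Rightarrow> real ^ 'd \<Rightarrow> (nat \<Rightarrow> real ^ 'd) measure" where
  "gaussian_law n \<theta> = distr (gaussian_sample n) (sample_space n) (translate n \<theta>)"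

definition likelihood_ratio :: "nat \<Rightarrow> real ^ 'd \<Rightarrow> (nat \<Rightarrow> real ^ 'd) \<Rightarrow> real" where
  "likelihood_ratio n \<theta> x = exp (\<theta> \<bullet> (\<Sum>i\<in>{1..n}. x i) - real n * (norm \<theta>)\<^sup>2 / 2)"

lemma sets_gaussian_sample [measurable_cong, simp]:
  "sets (gaussian_sample n) = sets (sample_space n)"
  unfolding gaussian_sample_def sample_space_def by (rule sets_PiM_cong) simp_all

lemma space_gaussian_sample [simp]: "space (gaussian_sample n) = space (sample_space n)"
  by (rule sets_eq_imp_space_eq) simp

lemma space_sample_space: "space (sample_space n) = {1..n} \<rightarrow>\<^sub>E UNIV"
  by (simp add: sample_space_def space_PiM)

lemma prob_space_gaussian_sample: "prob_space (gaussian_sample n)"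
  unfolding gaussian_sample_def by (intro prob_space_PiM prob_space_std_gaussian)

lemma measurable_coordinate [measurable (raw)]:
  "i \<in> {1..n} \<Longrightarrow> (\<lambda>x. x i) \<in> borel_measurable (sample_space n)"
  unfolding sample_space_def by measurable

lemma measurable_translate [measurable]: "translate n \<theta> \<in> sample_space n \<rightarrow>\<^sub>M sample_space n"
  unfolding translate_def sample_space_def by measurable

lemma measurable_likelihood_ratio [measurable]:
  "likelihood_ratio n \<theta> \<in> borel_measurable (sample_space n)"
  unfolding likelihood_ratio_def by measurable

lemma translate_in_space [simp]: "translate n \<theta> x \<in> space (sample_space n)"
  by (simp add: translate_def space_sample_space)

lemma sum_translate: "(\<Sum>i\<in>{1..n}. translate n \<theta> x i) = (\<Sum>i\<in>{1..n}. x i) + real n *\<^sub>R \<theta>"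
  by (simp add: translate_def sum.distrib sum_constant_scaleR del: sum_constant)

text \<open>Independence says that the joint law is the product of the marginal laws;
  \<open>n \<ge> 1\<close> keeps the index set nonempty for this characterisation. From here on the
  underlying space \<open>M\<close> is replaced by the canonical
  \<open>gaussian_sample\<close>.\<close>

lemma shifted_law_eq_gaussian_law:
  fixes U :: "nat \<Rightarrow> 'w \<Rightarrow> real ^ 'd"
  assumes "prob_space M" and n: "n \<ge> 1"
    and indep: "prob_space.indep_vars M (\<lambda>_. borel) U {1..n}"
    and distr: "\<And>i. i \<in> {1..n} \<Longrightarrow> distributed M lborel (U i) (\<lambda>x. ennreal (std_gaussian_density x))"
  shows "shifted_law M U n = gaussian_law n"
proof
  fix \<theta>
  interpret prob_space M by fact
  have rv: "U i \<in> borel_measurable M" if "i \<in> {1..n}" for i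
    using distributed_measurable[OF distr[OF that]] by simp
  have law: "distr M borel (U i) = std_gaussian" if "i \<in> {1..n}" for i
    using distributed_distr_eq_density[OF distr[OF that]]
    by (simp add: std_gaussian_def cong: distr_cong)
  have "distr M (sample_space n) (\<lambda>\<omega>. \<lambda>i\<in>{1..n}. U i \<omega>) = (\<Pi>\<^sub>M i\<in>{1..n}. distr M borel (U i))"
    using indep n rv unfolding sample_space_def by (subst (asm) indep_vars_iff_distr_eq_PiM') auto
  also have "\<dots> = gaussian_sample n"
    unfolding gaussian_sample_def by (intro PiM_cong) (simp_all add: law)
  finally have *: "gaussian_sample n = distr M (sample_space n) (\<lambda>\<omega>. \<lambda>i\<in>{1..n}. U i \<omega>)" ..
  have [measurable]: "(\<lambda>\<omega>. \<lambda>i\<in>{1..n}. U i \<omega>) \<in> M \<rightarrow>\<^sub>M sample_space n"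
    unfolding sample_space_def using rv by (intro measurable_restrict) auto
  have "gaussian_law n \<theta> = distr M (sample_space n) (translate n \<theta> \<circ> (\<lambda>\<omega>. \<lambda>i\<in>{1..n}. U i \<omega>))"
    unfolding gaussian_law_def * by (rule distr_distr) measurable
  also have "\<dots> = shifted_law M U n \<theta>"
    unfolding shifted_law_def by (rule distr_cong) (auto simp: translate_def)
  finally show "shifted_law M U n \<theta> = gaussian_law n \<theta>" ..
qed

text \<open>Translation acts coordinatewise, so the law is a product of shifted Gaussians; the
  coordinate densities multiply and their exponents add up to a function of the sum of the
  observations.\<close>

lemma gaussian_law_eq_density:
  "gaussian_law n \<theta> = density (gaussian_sample n) (\<lambda>x. ennreal (likelihood_ratio n \<theta> x))"
proof -
  define h where "h x = ennreal (exp (\<theta> \<bullet> x - (norm \<theta>)\<^sup>2 / 2))" for x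
  have shift: "distr std_gaussian borel (\<lambda>x. x + \<theta>) = density std_gaussian h"
    unfolding h_def by (rule distr_std_gaussian_shift)
  have [measurable]: "h \<in> borel_measurable borel" unfolding h_def by measurable
  interpret G: prob_space "std_gaussian :: (real ^ 'a) measure" by (rule prob_space_std_gaussian)
  interpret N: prob_space "density std_gaussian h"
    unfolding shift[symmetric] by (rule G.prob_space_distr) simp
  have "gaussian_law n \<theta> = distr (PiM {1..n} (\<lambda>_. std_gaussian)) (PiM {1..n} (\<lambda>_. std_gaussian)) (compose {1..n} (\<lambda>x. x + \<theta>))"
    unfolding gaussian_law_def gaussian_sample_def
    by (intro distr_cong) (auto simp: sample_space_def translate_def compose_def intro!: sets_PiM_cong)
  also have "\<dots> = PiM {1..n} (\<lambda>_. distr std_gaussian borel (\<lambda>x. x + \<theta>))"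
    by (subst distr_PiM_finite_prob_space') (auto simp: prob_space_std_gaussian intro!: PiM_cong distr_cong)
  also have "\<dots> = density (gaussian_sample n) (\<lambda>x. \<Prod>i\<in>{1..n}. h (x i))"
    unfolding shift gaussian_sample_def
    by (intro PiM_density product_sigma_finite.intro G.sigma_finite_measure_axioms
        N.sigma_finite_measure_axioms) simp_all
  also have "(\<lambda>x. \<Prod>i\<in>{1..n}. h (x i)) = (\<lambda>x. ennreal (likelihood_ratio n \<theta> x))"
    by (simp add: h_def likelihood_ratio_def prod_ennreal inner_sum_right sum_subtractf flip: exp_sum)
  finally show ?thesis .
qed

lemma likelihood_ratio_pos: "0 < likelihood_ratio n \<theta> x"
  by (simp add: likelihood_ratio_def)

lemma prob_space_gaussian_law: "prob_space (gaussian_law n \<theta>)"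
  unfolding gaussian_law_def
  by (intro prob_space.prob_space_distr prob_space_gaussian_sample) simp

lemma nn_integral_likelihood_ratio: "(\<integral>\<^sup>+x. ennreal (likelihood_ratio n \<theta> x) \<partial>gaussian_sample n) = 1"
proof -
  have "1 = (\<integral>\<^sup>+x. ennreal (likelihood_ratio n \<theta> x) * indicator (space (gaussian_sample n)) x \<partial>gaussian_sample n)"
    using prob_space.emeasure_space_1[OF prob_space_gaussian_law[of n \<theta>]]
    by (simp add: gaussian_law_eq_density emeasure_density)
  also have "\<dots> = (\<integral>\<^sup>+x. ennreal (likelihood_ratio n \<theta> x) \<partial>gaussian_sample n)"
    by (rule nn_integral_cong) simp
  finally show ?thesis ..
qed

lemma integrable_likelihood_ratio: "integrable (gaussian_sample n) (likelihood_ratio n \<theta>)"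
  using nn_integral_likelihood_ratio[of n \<theta>]
  by (intro integrableI_bounded) (simp_all add: less_imp_le[OF likelihood_ratio_pos])

section \<open>Power functions: continuity and behaviour at infinity\<close>

lemma testsD:
  assumes "\<phi> \<in> tests S"
  shows "\<phi> \<in> borel_measurable S" "x \<in> space S \<Longrightarrow> 0 \<le> \<phi> x" "x \<in> space S \<Longrightarrow> \<phi> x \<le> 1"
  using assms by (auto simp: tests_def)

text \<open>Here the parameter sits in the test, which suits limits at infinity and rotations; in
  \<open>test_power_likelihood\<close> it sits in the density, which suits continuity and
  averaging.\<close>

lemma test_power_translate:
  assumes "\<phi> \<in> tests (sample_space n)"
  shows "test_power (gaussian_law n) \<phi> \<theta> = (\<integral>x. \<phi> (translate n \<theta> x) \<partial>gaussian_sample n)"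
  using testsD(1)[OF assms] by (simp add: test_power_def gaussian_law_def integral_distr)

lemma test_power_likelihood:
  assumes "\<phi> \<in> tests (sample_space n)"
  shows "test_power (gaussian_law n) \<phi> \<theta> = (\<integral>x. \<phi> x * likelihood_ratio n \<theta> x \<partial>gaussian_sample n)"
  using testsD(1)[OF assms]
  by (simp add: test_power_def gaussian_law_eq_density integral_real_density
      less_imp_le[OF likelihood_ratio_pos] mult.commute)

lemma integrable_test_likelihood:
  assumes \<phi>: "\<phi> \<in> tests (sample_space n)"
  shows "integrable (gaussian_sample n) (\<lambda>x. \<phi> x * likelihood_ratio n \<theta> x)"
  using testsD[OF \<phi>]
  by (intro Bochner_Integration.integrable_bound[OF integrable_likelihood_ratio[of n \<theta>]])
    (auto simp: abs_mult less_imp_le[OF likelihood_ratio_pos] intro!: mult_left_le_one_le AE_I2)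

text \<open>Likelihood ratios are nonnegative, have integral 1 and are continuous in \<theta>, so
  Scheffe gives their convergence in mean; multiplying by a test with values in [0,1] does not
  increase the distance.\<close>

lemma continuous_test_power:
  fixes \<phi> :: "(nat \<Rightarrow> real ^ 'd) \<Rightarrow> real"
  assumes \<phi>: "\<phi> \<in> tests (sample_space n)"
  shows "continuous_on UNIV (test_power (gaussian_law n) \<phi>)"
proof (rule continuous_at_imp_continuous_on, intro ballI, unfold continuous_at_sequentially, intro allI impI)
  note [measurable] = testsD(1)[OF \<phi>]
  fix t and \<theta> :: "real ^ 'd" assume t: "t \<longlonglongrightarrow> \<theta>"
  let ?P = "gaussian_sample n :: (nat \<Rightarrow> real ^ 'd) measure"
  let ?L = "likelihood_ratio n :: real ^ 'd \<Rightarrow> _"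
  have "(\<lambda>k. \<integral>\<^sup>+x. ennreal (norm (?L (t k) x - ?L \<theta> x)) \<partial>?P) \<longlonglongrightarrow> 0"
  proof (rule Scheffe_lemma2)
    have "(\<lambda>k. ?L (t k) x) \<longlonglongrightarrow> ?L \<theta> x" for x
      unfolding likelihood_ratio_def by (intro tendsto_intros t) simp_all
    then show "AE x in ?P. (\<lambda>k. ?L (t k) x) \<longlonglongrightarrow> ?L \<theta> x" by simp
  qed (simp_all add: integrable_likelihood_ratio less_imp_le[OF likelihood_ratio_pos]
      nn_integral_likelihood_ratio)
  moreover have "(\<integral>\<^sup>+x. ennreal (norm (?L (t k) x - ?L \<theta> x)) \<partial>?P)
      = ennreal (\<integral>x. norm (?L (t k) x - ?L \<theta> x) \<partial>?P)" for k
    by (intro nn_integral_eq_integral Bochner_Integration.integrable_norm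
        Bochner_Integration.integrable_diff integrable_likelihood_ratio) simp_all
  ultimately have "(\<lambda>k. ennreal (\<integral>x. norm (?L (t k) x - ?L \<theta> x) \<partial>?P)) \<longlonglongrightarrow> ennreal 0"
    by simp
  then have lim: "(\<lambda>k. \<integral>x. norm (?L (t k) x - ?L \<theta> x) \<partial>?P) \<longlonglongrightarrow> 0"
    by (subst (asm) tendsto_ennreal_iff) simp_all
  have "norm (test_power (gaussian_law n) \<phi> (t k) - test_power (gaussian_law n) \<phi> \<theta>)
      \<le> (\<integral>x. norm (?L (t k) x - ?L \<theta> x) \<partial>?P)" for k
  proof -
    have "test_power (gaussian_law n) \<phi> (t k) - test_power (gaussian_law n) \<phi> \<theta>
        = (\<integral>x. \<phi> x * ?L (t k) x - \<phi> x * ?L \<theta> x \<partial>?P)"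
      by (simp add: test_power_likelihood[OF \<phi>] integrable_test_likelihood[OF \<phi>])
    also have "norm \<dots> \<le> (\<integral>x. norm (\<phi> x * ?L (t k) x - \<phi> x * ?L \<theta> x) \<partial>?P)"
      by simp
    also have "\<dots> \<le> (\<integral>x. norm (?L (t k) x - ?L \<theta> x) \<partial>?P)"
    proof (rule integral_mono)
      fix x assume "x \<in> space ?P"
      then have "norm (\<phi> x * (?L (t k) x - ?L \<theta> x)) \<le> norm (?L (t k) x - ?L \<theta> x)"
        using testsD[OF \<phi>] by (simp add: abs_mult mult_left_le_one_le)
      then show "norm (\<phi> x * ?L (t k) x - \<phi> x * ?L \<theta> x) \<le> norm (?L (t k) x - ?L \<theta> x)"
        by (simp add: right_diff_distrib)
    qed (auto intro!: integrable_test_likelihood[OF \<phi>] integrable_likelihood_ratio)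
    finally show ?thesis .
  qed
  then have "(\<lambda>k. test_power (gaussian_law n) \<phi> (t k) - test_power (gaussian_law n) \<phi> \<theta>) \<longlonglongrightarrow> 0"
    by (intro Lim_null_comparison[OF _ lim]) simp
  then show "(test_power (gaussian_law n) \<phi> \<circ> t) \<longlonglongrightarrow> test_power (gaussian_law n) \<phi> \<theta>"
    by (simp add: comp_def LIM_zero_iff)
qed

text \<open>Otherwise the error would stay at least \<open>\<epsilon>\<close> along parameters with
  norm tending to infinity, while dominated convergence with bound 1 sends the power along them to
  1. The set of large errors is therefore bounded and has compact closure.\<close>

lemma continuous_vanishing_type_II_error:
  fixes \<phi> :: "(nat \<Rightarrow> real ^ 'd) \<Rightarrow> real"
  assumes \<phi>: "\<phi> \<in> tests (sample_space n)"
    and reject: "\<And>x. \<forall>\<^sub>F \<theta> in at_infinity. \<phi> (translate n \<theta> x) = 1"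
  shows "(\<lambda>\<theta>. 1 - test_power (gaussian_law n) \<phi> \<theta>) \<in> continuous_vanishing"
proof -
  note [measurable] = testsD(1)[OF \<phi>]
  let ?\<beta> = "test_power (gaussian_law n) \<phi>"
  interpret prob_space "gaussian_sample n :: (nat \<Rightarrow> real ^ 'd) measure"
    by (rule prob_space_gaussian_sample)
  have "bounded {\<theta>. \<epsilon> \<le> \<bar>1 - ?\<beta> \<theta>\<bar>}" if "\<epsilon> > 0" for \<epsilon>
  proof (rule ccontr)
    assume "\<not> bounded {\<theta>. \<epsilon> \<le> \<bar>1 - ?\<beta> \<theta>\<bar>}"
    then have "\<exists>\<theta>. \<epsilon> \<le> \<bar>1 - ?\<beta> \<theta>\<bar> \<and> norm \<theta> > real k" for k
      unfolding bounded_iff by (force simp: not_le)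
    then obtain t where t: "\<And>k. \<epsilon> \<le> \<bar>1 - ?\<beta> (t k)\<bar>" "\<And>k. norm (t k) > real k"
      by metis
    have "filterlim (\<lambda>k. norm (t k)) at_top sequentially"
      by (rule filterlim_at_top_mono[OF filterlim_real_sequentially])
        (intro always_eventually allI less_imp_le t(2))
    then have "filterlim t at_infinity sequentially"
      by (rule filterlim_norm_at_top_imp_at_infinity)
    then have ev: "\<forall>\<^sub>F k in sequentially. \<phi> (translate n (t k) x) = 1" for x
      using reject[of x] by (rule eventually_compose_filterlim[rotated])
    have "(\<lambda>k. ?\<beta> (t k)) \<longlonglongrightarrow> (\<integral>x. 1 \<partial>(gaussian_sample n :: (nat \<Rightarrow> real ^ 'd) measure))"
      unfolding test_power_translate[OF \<phi>]
    proof (rule integral_dominated_convergence)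
      show "AE x in gaussian_sample n. (\<lambda>k. \<phi> (translate n (t k) x)) \<longlonglongrightarrow> 1"
        by (intro AE_I2 tendsto_eventually ev)
      show "AE x in gaussian_sample n. norm (\<phi> (translate n (t k) x)) \<le> 1" for k
        using testsD[OF \<phi>] by simp
    qed simp_all
    then have "(\<lambda>k. \<bar>1 - ?\<beta> (t k)\<bar>) \<longlonglongrightarrow> \<bar>1 - 1\<bar>"
      using prob_space by (intro tendsto_intros) simp
    then have "\<epsilon> \<le> \<bar>1 - 1\<bar>"
      by (rule tendsto_lowerbound) (simp_all add: t(1))
    with \<open>\<epsilon> > 0\<close> show False by simp
  qed
  then have "\<exists>K. compact K \<and> {\<theta>. \<epsilon> \<le> \<bar>1 - ?\<beta> \<theta>\<bar>} \<subseteq> K" if "\<epsilon> > 0" for \<epsilon>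
    using that by (intro exI[of _ "closure {\<theta>. \<epsilon> \<le> \<bar>1 - ?\<beta> \<theta>\<bar>}"] conjI closure_subset) auto
  then show ?thesis
    using continuous_test_power[OF \<phi>] by (auto simp: continuous_vanishing_def intro!: continuous_intros)
qed

section \<open>Directions, null hyperplanes and rotated samples\<close>

lemma orthogonal_transformation_sgn:
  "orthogonal_transformation f \<Longrightarrow> f (sgn x) = sgn (f x)"
  by (simp add: sgn_div_norm orthogonal_transformation linear_scale)

lemma AE_std_gaussian:
  assumes "AE x in lborel. P x"
  shows "AE x in std_gaussian. P x"
  unfolding std_gaussian_def using assms by (subst AE_density) auto

lemma AE_std_gaussian_inner_nonzero:
  fixes a :: "real ^ 'd"
  assumes "a \<noteq> 0"
  shows "AE x in std_gaussian. a \<bullet> x \<noteq> 0"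
proof (rule AE_std_gaussian)
  \<comment> \<open>\<open>negligible\<close> refers to the completed Lebesgue measure; as the
    hyperplane is Borel, it is null for \<open>lborel\<close> itself.\<close>
  have "{x. a \<bullet> x = 0} \<in> null_sets (completion lborel)"
    using negligible_hyperplane[of a 0] assms by (simp add: negligible_iff_null_sets)
  moreover have "{x. a \<bullet> x = 0} \<in> sets lborel" by measurable
  ultimately show "AE x in lborel. a \<bullet> x \<noteq> 0"
    by (intro AE_I'[of "{x. a \<bullet> x = 0}"]) (auto simp: null_sets_completion_iff)
qed

lemma measurable_sgn_euclidean [measurable]:
  "sgn \<in> borel_measurable (borel :: 'a::euclidean_space measure)"
  unfolding sgn_div_norm[abs_def] by measurable

lemma distr_gaussian_sample_orthogonal:
  fixes f :: "real ^ 'd \<Rightarrow> real ^ 'd"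
  assumes f: "orthogonal_transformation f"
  shows "distr (gaussian_sample n) (sample_space n) (compose {1..n} f) = gaussian_sample n"
proof -
  note [measurable] = orthogonal_transformation_measurable[OF f]
  have "distr (gaussian_sample n) (sample_space n) (compose {1..n} f)
      = distr (gaussian_sample n) (gaussian_sample n) (compose {1..n} f)"
    by (rule distr_cong) simp_all
  also have "\<dots> = (\<Pi>\<^sub>M i\<in>{1..n}. distr std_gaussian std_gaussian f)"
    unfolding gaussian_sample_def
    by (rule distr_PiM_finite_prob_space') (auto simp: prob_space_std_gaussian)
  also have "distr std_gaussian std_gaussian f = distr std_gaussian borel f"
    by (rule distr_cong) simp_all
  finally show ?thesis
    by (simp only: distr_std_gaussian_orthogonal[OF f] gaussian_sample_def)
qed

section \<open>Rotation invariant tests\<close>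

text \<open>A single transformation acts on all observations at once. Reflections are included, so
  that spheres are single orbits even in dimension one, where they consist of two opposite
  points.\<close>

definition rotation_invariant :: "nat \<Rightarrow> ((nat \<Rightarrow> real ^ 'd) \<Rightarrow> real) \<Rightarrow> bool" where
  "rotation_invariant n \<phi> \<longleftrightarrow>
    (\<forall>f. \<forall>x \<in> space (sample_space n). orthogonal_transformation f \<longrightarrow> \<phi> (compose {1..n} f x) = \<phi> x)"

text \<open>Rotating the noise preserves its law and turns the sample shifted by
  \<open>f \<theta>\<close> into the image under \<open>f\<close> of the sample shifted by
  \<open>\<theta>\<close>; an invariant test does not distinguish the two.\<close>

lemma test_power_rotation:
  fixes f :: "real ^ 'd \<Rightarrow> real ^ 'd"
  assumes \<phi>: "\<phi> \<in> tests (sample_space n)" and inv: "rotation_invariant n \<phi>"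
    and f: "orthogonal_transformation f"
  shows "test_power (gaussian_law n) \<phi> (f \<theta>) = test_power (gaussian_law n) \<phi> \<theta>"
proof -
  note [measurable] = testsD(1)[OF \<phi>] orthogonal_transformation_measurable[OF f]
  have [measurable]: "compose {1..n} f \<in> gaussian_sample n \<rightarrow>\<^sub>M sample_space n"
    unfolding compose_def sample_space_def gaussian_sample_def by measurable
  have "test_power (gaussian_law n) \<phi> (f \<theta>)
      = (\<integral>x. \<phi> (translate n (f \<theta>) x) \<partial>distr (gaussian_sample n) (sample_space n) (compose {1..n} f))"
    unfolding test_power_translate[OF \<phi>] distr_gaussian_sample_orthogonal[OF f] ..
  also have "\<dots> = (\<integral>x. \<phi> (translate n (f \<theta>) (compose {1..n} f x)) \<partial>gaussian_sample n)"
    by (rule integral_distr) measurable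
  also have "\<dots> = (\<integral>x. \<phi> (compose {1..n} f (translate n \<theta> x)) \<partial>gaussian_sample n)"
    using linear_add[OF orthogonal_transformation_linear[OF f]]
    by (intro Bochner_Integration.integral_cong refl arg_cong[of _ _ \<phi>])
      (auto simp: translate_def compose_def)
  also have "\<dots> = test_power (gaussian_law n) \<phi> \<theta>"
    using inv f by (simp add: test_power_translate[OF \<phi>] rotation_invariant_def)
  finally show ?thesis .
qed

text \<open>The direction \<open>sgn w\<close> of a Gaussian vector is uniform on the unit sphere,
  so this is the spherical mean of \<open>exp (r * (s \<bullet> u))\<close> over unit vectors
  \<open>u\<close>, written without a surface measure.\<close>

definition radial_kernel :: "real \<Rightarrow> real ^ 'd \<Rightarrow> real" where
  "radial_kernel r s = (\<integral>w. exp (r * (s \<bullet> sgn w)) \<partial>std_gaussian)"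

lemma integrable_radial_kernel: "integrable std_gaussian (\<lambda>w. exp (r * (s \<bullet> sgn w)))"
proof -
  interpret prob_space "std_gaussian :: (real ^ 'a) measure" by (rule prob_space_std_gaussian)
  have "r * (s \<bullet> sgn w) \<le> \<bar>r\<bar> * norm s" for w
  proof -
    have "\<bar>s \<bullet> sgn w\<bar> \<le> norm s * norm (sgn w)" by (rule Cauchy_Schwarz_ineq2)
    also have "\<dots> \<le> norm s" by (simp add: norm_sgn)
    finally have "\<bar>r * (s \<bullet> sgn w)\<bar> \<le> \<bar>r\<bar> * norm s"
      by (simp add: abs_mult mult_left_mono)
    then show ?thesis by linarith
  qed
  then show ?thesis
    by (intro integrable_const_bound[of _ "exp (\<bar>r\<bar> * norm s)"]) auto
qed

text \<open>Rotating \<open>w\<close> along with \<open>s\<close> keeps the inner product and the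
  Gaussian measure. Hence the kernel depends on \<open>s\<close> only through its norm.\<close>

lemma radial_kernel_orthogonal:
  fixes f :: "real ^ 'd \<Rightarrow> real ^ 'd"
  assumes f: "orthogonal_transformation f"
  shows "radial_kernel r (f s) = radial_kernel r s"
proof -
  note [measurable] = orthogonal_transformation_measurable[OF f]
  have "radial_kernel r (f s) = (\<integral>w. exp (r * (f s \<bullet> sgn w)) \<partial>distr std_gaussian borel f)"
    by (simp add: radial_kernel_def distr_std_gaussian_orthogonal[OF f])
  also have "\<dots> = (\<integral>w. exp (r * (f s \<bullet> sgn (f w))) \<partial>std_gaussian)"
    by (rule integral_distr) measurable
  also have "\<dots> = radial_kernel r s"
    using f by (simp add: radial_kernel_def orthogonal_transformation_def
        flip: orthogonal_transformation_sgn[OF f])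
  finally show ?thesis .
qed

text \<open>Averaging the equal values at \<open>s\<close> and \<open>- s\<close> replaces
  \<open>exp\<close> by \<open>cosh\<close>. Unlike \<open>exp\<close>, \<open>cosh\<close>
  increases with the absolute value of its argument, so integrands along a ray can be compared
  pointwise.\<close>

lemma
  shows integrable_radial_kernel_cosh: "integrable std_gaussian (\<lambda>w. cosh (r * (s \<bullet> sgn w)))"
    and radial_kernel_eq_cosh: "radial_kernel r s = (\<integral>w. cosh (r * (s \<bullet> sgn w)) \<partial>std_gaussian)"
proof -
  have *: "cosh (r * (s \<bullet> sgn w)) = (exp (r * (s \<bullet> sgn w)) + exp (r * (- s \<bullet> sgn w))) / 2" for w
    by (simp add: cosh_field_def)
  show "integrable std_gaussian (\<lambda>w. cosh (r * (s \<bullet> sgn w)))"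
    unfolding * by (intro Bochner_Integration.integrable_divide Bochner_Integration.integrable_add
        integrable_radial_kernel)
  have "(\<integral>w. cosh (r * (s \<bullet> sgn w)) \<partial>std_gaussian) = (radial_kernel r s + radial_kernel r (- s)) / 2"
    unfolding * radial_kernel_def
    by (subst integral_divide_zero, subst Bochner_Integration.integral_add) (rule integrable_radial_kernel refl)+
  also have "radial_kernel r (- s) = radial_kernel r s"
    by (rule radial_kernel_orthogonal) (simp add: orthogonal_transformation_neg orthogonal_transformation_id)
  finally show "radial_kernel r s = (\<integral>w. cosh (r * (s \<bullet> sgn w)) \<partial>std_gaussian)" by simp
qed

text \<open>By invariance \<open>s\<close> may be taken to be a multiple of \<open>t\<close> with
  factor in [0,1). The \<open>cosh\<close> integrands are then strictly ordered off the null
  hyperplane orthogonal to \<open>t\<close>.\<close>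

lemma radial_kernel_strict_mono:
  fixes s t :: "real ^ 'd"
  assumes "0 < r" "norm s < norm t"
  shows "radial_kernel r s < radial_kernel r t"
proof -
  interpret prob_space "std_gaussian :: (real ^ 'd) measure" by (rule prob_space_std_gaussian)
  define c where "c = norm s / norm t"
  have t: "t \<noteq> 0" and c: "0 \<le> c" "c < 1" using assms by (auto simp: c_def divide_simps)
  have "norm (c *\<^sub>R t) = norm s" using t by (simp add: c_def)
  then obtain f where f: "orthogonal_transformation f" "f (c *\<^sub>R t) = s"
    by (rule orthogonal_transformation_exists)
  have "radial_kernel r s = radial_kernel r (c *\<^sub>R t)"
    using radial_kernel_orthogonal[OF f(1), of r "c *\<^sub>R t"] f(2) by simp
  also have "\<dots> < radial_kernel r t"
    unfolding radial_kernel_eq_cosh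
  proof (rule integral_less_AE_space)
    show "AE w in std_gaussian. cosh (r * (c *\<^sub>R t \<bullet> sgn w)) < cosh (r * (t \<bullet> sgn w))"
      using AE_std_gaussian_inner_nonzero[OF t]
    proof eventually_elim
      case (elim w)
      then have nz: "t \<bullet> sgn w \<noteq> 0" by (auto simp: sgn_div_norm)
      have "cosh (r * (c *\<^sub>R t \<bullet> sgn w)) = cosh \<bar>r * (c * (t \<bullet> sgn w))\<bar>" by (simp add: cosh_real_abs)
      also have "\<bar>r * (c * (t \<bullet> sgn w))\<bar> = c * \<bar>r * (t \<bullet> sgn w)\<bar>" using c by (simp add: abs_mult)
      also have "cosh (c * \<bar>r * (t \<bullet> sgn w)\<bar>) < cosh \<bar>r * (t \<bullet> sgn w)\<bar>"
        using c nz \<open>0 < r\<close> by (subst cosh_real_nonneg_less_iff) auto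
      finally show ?case by (simp add: cosh_real_abs)
    qed
  qed (rule integrable_radial_kernel_cosh | simp add: emeasure_space_1[simplified])+
  finally show ?thesis .
qed

lemma radial_kernel_mono:
  fixes s t :: "real ^ 'd"
  assumes "0 < r" "norm s \<le> norm t"
  shows "radial_kernel r s \<le> radial_kernel r t"
proof (cases "norm s = norm t")
  case True
  then obtain f where "orthogonal_transformation f" "f s = t"
    by (rule orthogonal_transformation_exists)
  then show ?thesis using radial_kernel_orthogonal[of f r s] by simp
next
  case False
  then show ?thesis using radial_kernel_strict_mono[of r s t] assms by simp
qed

text \<open>An invariant test has the same power at all points of a sphere; the power is averaged over the
  sphere by means of the direction of a Gaussian vector.\<close>

lemma test_power_radial:
  fixes \<theta> :: "real ^ 'd"
  assumes \<phi>: "\<phi> \<in> tests (sample_space n)" and inv: "rotation_invariant n \<phi>"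
  defines "k \<equiv> \<lambda>x. exp (- (real n * (norm \<theta>)\<^sup>2 / 2)) * radial_kernel (norm \<theta>) (\<Sum>i\<in>{1..n}. x i)"
  shows "integrable (gaussian_sample n) (\<lambda>x. \<phi> x * k x)" (is ?int)
    and "test_power (gaussian_law n) \<phi> \<theta> = (\<integral>x. \<phi> x * k x \<partial>gaussian_sample n)" (is ?eq)
proof -
  note [measurable] = testsD(1)[OF \<phi>]
  let ?P = "gaussian_sample n :: (nat \<Rightarrow> real ^ 'd) measure"
  let ?G = "std_gaussian :: (real ^ 'd) measure"
  let ?\<beta> = "test_power (gaussian_law n) \<phi>"
  \<comment> \<open>The integrand of the power at the random point
    \<open>norm \<theta> *\<^sub>R sgn w\<close> of the sphere through \<open>\<theta>\<close>.
    Exchanging the integrals moves the average from the power to the likelihood ratio.\<close>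
  define F where "F w x = \<phi> x * likelihood_ratio n (norm \<theta> *\<^sub>R sgn w) x" for w x
  interpret G: prob_space ?G by (rule prob_space_std_gaussian)
  interpret P: prob_space ?P by (rule prob_space_gaussian_sample)
  interpret pair_sigma_finite ?G ?P ..
  have [measurable]: "(\<lambda>p. sgn (fst p)) \<in> borel_measurable (?G \<Otimes>\<^sub>M ?P)"
    by (intro measurable_compose[OF measurable_fst]) simp
  have [measurable]: "(\<lambda>p. \<Sum>i\<in>{1..n}. snd p i) \<in> borel_measurable (?G \<Otimes>\<^sub>M ?P)"
    by (intro borel_measurable_sum measurable_compose[OF measurable_snd]) simp
  have [measurable]: "(\<lambda>(w, x). F w x) \<in> borel_measurable (?G \<Otimes>\<^sub>M ?P)"
    unfolding F_def likelihood_ratio_def by measurable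
  have nonzero: "AE w in ?G. w \<noteq> 0" by (intro AE_std_gaussian AE_lborel_singleton)
  have power: "?\<beta> (norm \<theta> *\<^sub>R sgn w) = ?\<beta> \<theta>" if "w \<noteq> 0" for w
  proof -
    have "norm \<theta> = norm (norm \<theta> *\<^sub>R sgn w)" using that by (simp add: norm_sgn)
    then obtain f where "orthogonal_transformation f" "f \<theta> = norm \<theta> *\<^sub>R sgn w"
      by (rule orthogonal_transformation_exists)
    then show ?thesis using test_power_rotation[OF \<phi> inv, of f \<theta>] by simp
  qed
  have F_int: "integrable ?P (F w)" and F_eq: "(\<integral>x. F w x \<partial>?P) = ?\<beta> (norm \<theta> *\<^sub>R sgn w)" for w
    unfolding F_def using integrable_test_likelihood[OF \<phi>] test_power_likelihood[OF \<phi>] by simp_all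
  have F_nonneg: "0 \<le> F w x" if "x \<in> space ?P" for w x
    using that testsD(2)[OF \<phi>, of x] by (simp add: F_def less_imp_le[OF likelihood_ratio_pos])
  have F_AE: "AE w in ?G. (\<integral>x. F w x \<partial>?P) = ?\<beta> \<theta>"
    using nonzero by eventually_elim (simp add: F_eq power)
  \<comment> \<open>\<open>F\<close> is nonnegative on the sample space and its integral over
    samples is almost everywhere the constant \<open>?\<beta> \<theta>\<close>, so the integrability
    condition of Fubini reduces to that of a constant.\<close>
  have int: "integrable (?G \<Otimes>\<^sub>M ?P) (\<lambda>(w, x). F w x)"
  proof (rule Fubini_integrable)
    have "(\<integral>x. norm (case (w, x) of (w, x) \<Rightarrow> F w x) \<partial>?P) = (\<integral>x. F w x \<partial>?P)" for w
      using F_nonneg by (intro Bochner_Integration.integral_cong) auto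
    moreover have "integrable ?G (\<lambda>w. \<integral>x. F w x \<partial>?P)"
      using F_AE by (subst integrable_cong_AE[of _ _ "\<lambda>_. ?\<beta> \<theta>"]) auto
    ultimately show "integrable ?G (\<lambda>w. \<integral>x. norm (case (w, x) of (w, x) \<Rightarrow> F w x) \<partial>?P)"
      by simp
  qed (simp_all add: F_int)
  have F_kernel: "(\<integral>w. F w x \<partial>?G) = \<phi> x * k x" for x
  proof -
    have "(\<integral>w. F w x \<partial>?G) = (\<integral>w. \<phi> x * exp (- (real n * (norm \<theta>)\<^sup>2 / 2)) * exp (norm \<theta> * ((\<Sum>i\<in>{1..n}. x i) \<bullet> sgn w)) \<partial>?G)"
    proof (rule integral_cong_AE)
      \<comment> \<open>The exception is \<open>w = 0\<close>: there \<open>sgn w\<close> has norm 0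
        instead of 1, so the normalising factor may differ.\<close>
      show "AE w in ?G. F w x = \<phi> x * exp (- (real n * (norm \<theta>)\<^sup>2 / 2)) * exp (norm \<theta> * ((\<Sum>i\<in>{1..n}. x i) \<bullet> sgn w))"
        using nonzero
        by eventually_elim (simp add: F_def likelihood_ratio_def norm_sgn inner_commute flip: exp_add)
    qed (simp_all add: F_def likelihood_ratio_def)
    then show ?thesis by (simp add: k_def radial_kernel_def)
  qed
  show ?int using integrable_snd[OF int] by (simp add: F_kernel)
  have "?\<beta> \<theta> = (\<integral>w. ?\<beta> \<theta> \<partial>?G)" using G.prob_space by simp
  also have "\<dots> = (\<integral>w. \<integral>x. F w x \<partial>?P \<partial>?G)"
    using F_AE by (intro integral_cong_AE) auto
  also have "\<dots> = (\<integral>x. \<integral>w. F w x \<partial>?G \<partial>?P)"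
    by (rule Fubini_integral[OF int, symmetric])
  also have "\<dots> = (\<integral>x. \<phi> x * k x \<partial>?P)" by (simp add: F_kernel)
  finally show ?eq .
qed

text \<open>\<open>c\<close> is the lower quantile of order \<open>1 - \<alpha>\<close>: the mass
  above \<open>c\<close> is at most \<alpha>, the mass from \<open>c\<close> on at least \<alpha>. A
  fraction \<open>\<gamma>\<close> of the atom at \<open>c\<close> makes up the difference.\<close>

lemma (in real_distribution) randomised_quantile:
  assumes "0 < \<alpha>" "\<alpha> < 1"
  obtains c \<gamma> where "0 \<le> \<gamma>" "\<gamma> \<le> 1" "measure M {c<..} + \<gamma> * measure M {c} = \<alpha>"
proof -
  define S where "S = {t. 1 - \<alpha> \<le> cdf M t}"
  define c where "c = Inf S"
  have "\<forall>\<^sub>F t in at_top. 1 - \<alpha> < cdf M t"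
    using cdf_lim_at_top_prob assms by (intro order_tendstoD) auto
  then have "S \<noteq> {}"
    by (auto simp: S_def eventually_at_top_linorder intro: less_imp_le)
  have "\<forall>\<^sub>F t in at_bot. cdf M t < 1 - \<alpha>"
    using cdf_lim_at_bot assms by (intro order_tendstoD) auto
  then obtain b where b: "\<And>t. t \<le> b \<Longrightarrow> cdf M t < 1 - \<alpha>"
    by (auto simp: eventually_at_bot_linorder)
  have "b \<le> t" if "t \<in> S" for t
    using b[of t] that by (cases "t \<le> b") (auto simp: S_def)
  then have bdd: "bdd_below S" by (rule bdd_belowI)
  have below: "cdf M t < 1 - \<alpha>" if "t < c" for t
    using cInf_lower[OF _ bdd, of t] that by (auto simp: c_def S_def not_le[symmetric])
  have above: "1 - \<alpha> \<le> cdf M t" if t: "c < t" for t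
  proof -
    obtain s where "s \<in> S" "s < t"
      using cInf_lessD[OF \<open>S \<noteq> {}\<close>, of t] t unfolding c_def by blast
    then show ?thesis using cdf_nondecreasing[of s t] by (simp add: S_def)
  qed
  \<comment> \<open>Right continuity of the distribution function puts the infimum \<open>c\<close>
    itself into \<open>S\<close>.\<close>
  have "1 - \<alpha> \<le> cdf M c"
    using cdf_is_right_cont[of c] above
    by (intro tendsto_lowerbound[of "cdf M" _ "at_right c"])
      (auto simp: continuous_within eventually_at_filter)
  moreover have "cdf M c = 1 - measure M {c<..}"
    using prob_compl[of "{c<..}"] by (simp add: cdf_def Compl_eq_Diff_UNIV[symmetric])
  ultimately have le: "measure M {c<..} \<le> \<alpha>" by simp
  \<comment> \<open>The mass strictly below \<open>c\<close> is the left limit of the distribution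
    function, taken along points outside \<open>S\<close>.\<close>
  have "measure M {..<c} \<le> 1 - \<alpha>"
    using cdf_at_left[of c] below
    by (intro tendsto_upperbound[of "cdf M" _ "at_left c"])
      (auto simp: eventually_at_filter intro!: always_eventually less_imp_le)
  moreover have "measure M {..<c} = 1 - measure M {c..}"
    using prob_compl[of "{c..}"] by (simp add: Compl_eq_Diff_UNIV[symmetric])
  moreover have "measure M {c..} = measure M {c} + measure M {c<..}"
    by (subst finite_measure_Union[symmetric]) (auto intro!: arg_cong[of _ _ "measure M"])
  ultimately have ge: "\<alpha> \<le> measure M {c<..} + measure M {c}" by simp
  \<comment> \<open>Without an atom at \<open>c\<close> the quotient is 0 by the convention for
    division by zero, and the two bounds already give
    \<open>measure M {c<..} = \<alpha>\<close>.\<close>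
  show ?thesis
  proof (rule that[of "(\<alpha> - measure M {c<..}) / measure M {c}" c])
  qed (use le ge measure_nonneg[of M "{c}"] in \<open>auto simp: divide_simps\<close>)
qed

section \<open>The test based on the norm of the sum\<close>

definition threshold_test :: "nat \<Rightarrow> real \<Rightarrow> real \<Rightarrow> (nat \<Rightarrow> real ^ 'd) \<Rightarrow> real" where
  "threshold_test n c \<gamma> x =
    indicat_real {c<..} (norm (\<Sum>i\<in>{1..n}. x i)) + \<gamma> * indicat_real {c} (norm (\<Sum>i\<in>{1..n}. x i))"

lemma threshold_test_in_tests:
  assumes "0 \<le> \<gamma>" "\<gamma> \<le> 1"
  shows "threshold_test n c \<gamma> \<in> tests (sample_space n)"
  using assms unfolding tests_def threshold_test_def by (auto simp: indicator_def)

lemma sum_compose_orthogonal: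
  assumes "orthogonal_transformation f" "I \<subseteq> {1..n}"
  shows "(\<Sum>i\<in>I. compose {1..n} f x i) = f (\<Sum>i\<in>I. x i)"
  using assms(2) linear_sum[OF orthogonal_transformation_linear[OF assms(1)], of x I]
  by (auto simp: compose_def subset_iff intro!: sum.cong)

lemma rotation_invariant_threshold_test: "rotation_invariant n (threshold_test n c \<gamma>)"
  unfolding rotation_invariant_def threshold_test_def
  by (intro allI ballI impI)
    (simp only: sum_compose_orthogonal[OF _ order_refl] orthogonal_transformation_norm)

text \<open>The shift moves the sum by \<open>real n *\<^sub>R \<theta>\<close>, whose norm is at
  least that of \<open>\<theta>\<close>; the triangle inequality then pushes the norm of the sum
  past \<open>c\<close>.\<close>

lemma eventually_threshold_test:
  fixes x :: "nat \<Rightarrow> real ^ 'd"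
  assumes "n \<ge> 1"
  shows "\<forall>\<^sub>F \<theta> in at_infinity. threshold_test n c \<gamma> (translate n \<theta> x) = 1"
  unfolding eventually_at_infinity
proof (intro exI allI impI)
  fix \<theta> :: "real ^ 'd" assume \<theta>: "norm (\<Sum>i\<in>{1..n}. x i) + \<bar>c\<bar> + 1 \<le> norm \<theta>"
  have "norm \<theta> \<le> norm (real n *\<^sub>R \<theta>)"
    using assms mult_right_mono[of 1 "real n" "norm \<theta>"] by simp
  also have "\<dots> \<le> norm (\<Sum>i\<in>{1..n}. x i) + norm ((\<Sum>i\<in>{1..n}. x i) + real n *\<^sub>R \<theta>)"
    using norm_triangle_ineq4[of "(\<Sum>i\<in>{1..n}. x i) + real n *\<^sub>R \<theta>" "\<Sum>i\<in>{1..n}. x i"] by simp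
  finally have "c < norm (\<Sum>i\<in>{1..n}. translate n \<theta> x i)"
    unfolding sum_translate using \<theta> by linarith
  then show "threshold_test n c \<gamma> (translate n \<theta> x) = 1"
    by (simp add: threshold_test_def)
qed

lemma test_power_zero:
  assumes "\<phi> \<in> tests (sample_space n)"
  shows "test_power (gaussian_law n) \<phi> 0 = (\<integral>x. \<phi> x \<partial>gaussian_sample n)"
  by (simp add: test_power_likelihood[OF assms] likelihood_ratio_def)

text \<open>The randomised quantile is taken for the law of the norm of the sum under pure noise. A
  negative \<open>c\<close> would reject every sample, against \<open>\<alpha> < 1\<close>;
  nonnegativity later makes \<open>c\<close> the norm of some vector.\<close>

lemma threshold_test_level:
  assumes "0 < \<alpha>" "\<alpha> < 1"
  obtains c \<gamma> where "0 \<le> c" "0 \<le> \<gamma>" "\<gamma> \<le> 1"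
    "test_power (gaussian_law n) (threshold_test n c \<gamma> :: (nat \<Rightarrow> real ^ 'd) \<Rightarrow> real) 0 = \<alpha>"
proof -
  let ?P = "gaussian_sample n :: (nat \<Rightarrow> real ^ 'd) measure"
  define \<nu> where "\<nu> = distr ?P borel (\<lambda>x. norm (\<Sum>i\<in>{1..n}. x i))"
  interpret P: prob_space ?P by (rule prob_space_gaussian_sample)
  interpret \<nu>: real_distribution \<nu>
    unfolding \<nu>_def by (rule P.real_distribution_distr) measurable
  obtain c \<gamma> where \<gamma>: "0 \<le> \<gamma>" "\<gamma> \<le> 1" and c: "measure \<nu> {c<..} + \<gamma> * measure \<nu> {c} = \<alpha>"
    using \<nu>.randomised_quantile[OF assms] by blast
  have "c \<ge> 0"
  proof (rule ccontr)
    assume "\<not> c \<ge> 0"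
    then have vimage: "(\<lambda>x :: nat \<Rightarrow> real ^ 'd. norm (\<Sum>i\<in>{1..n}. x i)) -` {c<..} = UNIV"
      by (auto simp: not_le intro: less_le_trans[OF _ norm_ge_zero])
    have "measure \<nu> {c<..} = measure ?P (space ?P)"
      unfolding \<nu>_def by (subst measure_distr) (simp_all only: vimage, simp_all)
    then have "1 + \<gamma> * measure \<nu> {c} = \<alpha>"
      using c P.prob_space by simp
    moreover have "0 \<le> \<gamma> * measure \<nu> {c}" using \<gamma> by simp
    ultimately show False using assms by linarith
  qed
  have "test_power (gaussian_law n) (threshold_test n c \<gamma> :: (nat \<Rightarrow> real ^ 'd) \<Rightarrow> real) 0
      = (\<integral>t. indicat_real {c<..} t + \<gamma> * indicat_real {c} t \<partial>\<nu>)"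
    unfolding test_power_zero[OF threshold_test_in_tests[OF \<gamma>]] threshold_test_def \<nu>_def
    by (rule integral_distr[symmetric]) measurable
  also have "\<dots> = (\<integral>t. indicat_real {c<..} t \<partial>\<nu>) + (\<integral>t. \<gamma> * indicat_real {c} t \<partial>\<nu>)"
    by (intro Bochner_Integration.integral_add integrable_mult_right \<nu>.integrable_const_bound[of _ 1])
      (auto simp: indicator_def)
  also have "\<dots> = \<alpha>" using c by simp
  finally show ?thesis using that \<open>c \<ge> 0\<close> \<gamma> by blast
qed

text \<open>Neyman--Pearson for the averaged likelihood ratio, which is an increasing function of the norm of
  the sum of the observations.\<close>

lemma threshold_test_more_powerful:
  fixes \<phi> :: "(nat \<Rightarrow> real ^ 'd) \<Rightarrow> real"
  assumes \<phi>: "\<phi> \<in> tests (sample_space n)" and inv: "rotation_invariant n \<phi>"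
    and "0 \<le> c" and \<gamma>: "0 \<le> \<gamma>" "\<gamma> \<le> 1"
    and level: "test_power (gaussian_law n) (threshold_test n c \<gamma> :: (nat \<Rightarrow> real ^ 'd) \<Rightarrow> real) 0
      = test_power (gaussian_law n) \<phi> 0"
    and A: "A \<in> sets (sample_space n)" "emeasure (gaussian_sample n) A \<noteq> 0"
    and accept: "\<And>x. x \<in> A \<Longrightarrow> \<phi> x = 0 \<and> c < norm (\<Sum>i\<in>{1..n}. x i)"
    and "\<theta> \<noteq> 0"
  shows "test_power (gaussian_law n) \<phi> \<theta> < test_power (gaussian_law n) (threshold_test n c \<gamma>) \<theta>"
proof -
  let ?P = "gaussian_sample n :: (nat \<Rightarrow> real ^ 'd) measure"
  let ?\<phi>' = "threshold_test n c \<gamma> :: (nat \<Rightarrow> real ^ 'd) \<Rightarrow> real"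
  interpret P: prob_space ?P by (rule prob_space_gaussian_sample)
  define K where "K s = exp (- (real n * (norm \<theta>)\<^sup>2 / 2)) * radial_kernel (norm \<theta>) s" for s :: "real ^ 'd"
  \<comment> \<open>Any vector on the boundary sphere; \<open>K v\<close> is the critical value of
    the averaged likelihood ratio.\<close>
  obtain v :: "real ^ 'd" where v: "norm v = c" using \<open>0 \<le> c\<close> by (rule vector_choose_size)
  let ?S = "\<lambda>x :: nat \<Rightarrow> real ^ 'd. \<Sum>i\<in>{1..n}. x i"
  have \<phi>': "?\<phi>' \<in> tests (sample_space n)" using \<gamma> by (rule threshold_test_in_tests)
  have int: "integrable ?P \<psi>" if "\<psi> \<in> tests (sample_space n)" for \<psi>
    using testsD[OF that] by (intro P.integrable_const_bound[of _ 1]) auto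
  \<comment> \<open>The two tests have equal level, so level times \<open>K v\<close> is the same
    constant for both. Subtracting it leaves integrands with the factor
    \<open>K (?S x) - K v\<close>.\<close>
  have power: "integrable ?P (\<lambda>x. \<psi> x * K (?S x) - \<psi> x * K v)"
    "test_power (gaussian_law n) \<psi> \<theta> - test_power (gaussian_law n) \<psi> 0 * K v
      = (\<integral>x. \<psi> x * K (?S x) - \<psi> x * K v \<partial>?P)"
    if \<psi>: "\<psi> \<in> tests (sample_space n)" and "rotation_invariant n \<psi>" for \<psi>
    using test_power_radial[OF that, of \<theta>] int[OF \<psi>]
    by (simp_all add: test_power_zero[OF \<psi>] K_def)
  have mono: "K s \<le> K t" if "norm s \<le> norm t" for s t
    using radial_kernel_mono[of "norm \<theta>" s t] that \<open>\<theta> \<noteq> 0\<close> by (simp add: K_def)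
  have strict: "K s < K t" if "norm s < norm t" for s t
    using radial_kernel_strict_mono[of "norm \<theta>" s t] that \<open>\<theta> \<noteq> 0\<close> by (simp add: K_def)
  have "(\<integral>x. \<phi> x * K (?S x) - \<phi> x * K v \<partial>?P) < (\<integral>x. ?\<phi>' x * K (?S x) - ?\<phi>' x * K v \<partial>?P)"
  proof (rule P.integral_less_AE[where A = A])
    \<comment> \<open>The threshold test takes the extreme value favoured by the sign of
      \<open>K (?S x) - K v\<close>; on the boundary sphere this difference vanishes.\<close>
    have "\<phi> x * (K (?S x) - K v) \<le> ?\<phi>' x * (K (?S x) - K v)" if "x \<in> space ?P" for x
    proof (cases "norm (?S x)" c rule: linorder_cases)
      case less
      then have "?\<phi>' x = 0" "K (?S x) \<le> K v" using mono v by (simp_all add: threshold_test_def)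
      then show ?thesis using testsD(2)[OF \<phi>, of x] that by (simp add: mult_nonneg_nonpos)
    next
      case equal
      then have "K (?S x) = K v" using mono v by (intro antisym) simp_all
      then show ?thesis by simp
    next
      case greater
      then have "?\<phi>' x = 1" "K v \<le> K (?S x)" using mono v by (simp_all add: threshold_test_def)
      then show ?thesis using testsD(3)[OF \<phi>, of x] that by (intro mult_right_mono) simp_all
    qed
    then show "AE x in ?P. \<phi> x * K (?S x) - \<phi> x * K v \<le> ?\<phi>' x * K (?S x) - ?\<phi>' x * K v"
      by (intro AE_I2) (simp add: right_diff_distrib)
    have "\<phi> x * K (?S x) - \<phi> x * K v \<noteq> ?\<phi>' x * K (?S x) - ?\<phi>' x * K v" if "x \<in> A" for x
      using accept[OF that] strict[of v "?S x"] v by (simp add: threshold_test_def)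
    then show "AE x in ?P. x \<in> A \<longrightarrow> \<phi> x * K (?S x) - \<phi> x * K v \<noteq> ?\<phi>' x * K (?S x) - ?\<phi>' x * K v"
      by simp
  qed (use A power(1) \<phi> inv \<phi>' rotation_invariant_threshold_test in auto)
  then show ?thesis
    using power(2)[OF \<phi> inv] power(2)[OF \<phi>' rotation_invariant_threshold_test]
    unfolding level by linarith
qed

section \<open>The rejection zone\<close>

text \<open>The density is positive everywhere, so a Gaussian null set is Lebesgue null, whereas
  balls have positive volume.\<close>

lemma emeasure_std_gaussian_ball:
  assumes "r > 0"
  shows "emeasure std_gaussian (ball (a :: real ^ 'd) r) \<noteq> 0"
proof
  assume "emeasure std_gaussian (ball a r) = 0"
  then have "ball a r \<in> null_sets std_gaussian" by (simp add: null_sets_def)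
  then have "AE x in lborel. x \<in> ball a r \<longrightarrow> ennreal (std_gaussian_density x) = 0"
    unfolding std_gaussian_def by (subst (asm) null_sets_density_iff) auto
  then have "AE x in lborel. x \<notin> ball a r"
    by eventually_elim (auto simp: ennreal_eq_0_iff std_gaussian_density_pos[unfolded not_le[symmetric]])
  then have "emeasure lborel (ball a r) = 0"
    by (subst (asm) AE_iff_measurable[of "ball a r"]) auto
  moreover have "unit_ball_vol (real CARD('d)) > 0" by simp
  ultimately show False
    using assms by (simp add: emeasure_ball)
qed

lemma measurable_means [measurable]:
  assumes "m < n"
  shows "first_mean m \<in> borel_measurable (sample_space n)"
    and "second_mean m n \<in> borel_measurable (sample_space n)"
  unfolding first_mean_def second_mean_def using assms
  by (intro borel_measurable_scaleR borel_measurable_sum borel_measurable_const measurable_coordinate; simp)+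

lemma rejection_zone_in_tests:
  assumes "m < n"
  shows "indicat_real (rejection_zone m n D) \<in> tests (sample_space n)"
proof -
  note [measurable] = measurable_means[OF assms]
  have "rejection_zone m n D \<in> sets (sample_space n)"
    unfolding rejection_zone_def by measurable
  then show ?thesis by (auto simp: tests_def intro!: borel_measurable_indicator)
qed

text \<open>Both means commute with linear maps, and orthogonal maps preserve inner products and
  norms.\<close>

lemma rotation_invariant_rejection_zone:
  assumes "m < n"
  shows "rotation_invariant n (indicat_real (rejection_zone m n D :: (nat \<Rightarrow> real ^ 'd) set))"
  unfolding rotation_invariant_def
proof (intro allI ballI impI)
  fix f :: "real ^ 'd \<Rightarrow> real ^ 'd" and x :: "nat \<Rightarrow> real ^ 'd"
  assume x: "x \<in> space (sample_space n)" and f: "orthogonal_transformation f"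
  have "first_mean m (compose {1..n} f x) = f (first_mean m x)"
    "second_mean m n (compose {1..n} f x) = f (second_mean m n x)"
    using assms f unfolding first_mean_def second_mean_def
    by (simp_all only: linear_scale[OF orthogonal_transformation_linear[OF f]])
      (subst sum_compose_orthogonal[OF f]; auto)+
  moreover have "f y = 0 \<longleftrightarrow> y = 0" for y
    using orthogonal_transformation_norm[OF f, of y] by (metis norm_eq_zero)
  moreover have "compose {1..n} f x \<in> space (sample_space n)"
    by (simp add: space_sample_space compose_def)
  ultimately show "indicat_real (rejection_zone m n D) (compose {1..n} f x)
      = indicat_real (rejection_zone m n D) x"
    using f x by (simp add: rejection_zone_def indicator_def orthogonal_transformation_def
        orthogonal_transformation_norm)
qed

text \<open>For shifted means \<open>a + \<theta>\<close> and \<open>b + \<theta>\<close>,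
  Cauchy-Schwarz bounds the statistic below by \<open>norm (a + \<theta>) - norm (b - a)\<close>,
  which eventually exceeds \<open>D\<close>.\<close>

lemma eventually_rejection_zone:
  fixes x :: "nat \<Rightarrow> real ^ 'd"
  assumes "1 \<le> m" "m < n"
  shows "\<forall>\<^sub>F \<theta> in at_infinity. indicat_real (rejection_zone m n D) (translate n \<theta> x) = 1"
  unfolding eventually_at_infinity
proof (intro exI allI impI)
  define a b where "a = first_mean m x" and "b = second_mean m n x"
  fix \<theta> :: "real ^ 'd" assume \<theta>: "norm a + norm (b - a) + \<bar>D\<bar> + 1 \<le> norm \<theta>"
  have "(\<Sum>i\<in>I. translate n \<theta> x i) = (\<Sum>i\<in>I. x i) + real (card I) *\<^sub>R \<theta>" if "I \<subseteq> {1..n}" for I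
    using that by (simp add: translate_def subset_iff sum.distrib sum_constant_scaleR del: sum_constant cong: sum.cong)
  then have means: "first_mean m (translate n \<theta> x) = a + \<theta>" "second_mean m n (translate n \<theta> x) = b + \<theta>"
    using assms by (simp_all add: first_mean_def second_mean_def a_def b_def scaleR_add_right)
  have "norm \<theta> \<le> norm (a + \<theta>) + norm a"
    using norm_triangle_ineq4[of "a + \<theta>" a] by simp
  then have nz: "norm (a + \<theta>) > norm (b - a) + \<bar>D\<bar>" using \<theta> by linarith
  then have pos: "norm (a + \<theta>) > 0" using norm_ge_zero[of "b - a"] by linarith
  have "(a + \<theta>) \<bullet> (b + \<theta>) = (a + \<theta>) \<bullet> (a + \<theta>) + (a + \<theta>) \<bullet> (b - a)"
    by (simp add: add.commute flip: inner_add_right)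
  also have "\<dots> \<ge> norm (a + \<theta>) * norm (a + \<theta>) - norm (a + \<theta>) * norm (b - a)"
    using Cauchy_Schwarz_ineq2[of "a + \<theta>" "b - a"]
    unfolding dot_square_norm power2_eq_square by linarith
  finally have "norm (a + \<theta>) * (norm (a + \<theta>) - norm (b - a)) \<le> (a + \<theta>) \<bullet> (b + \<theta>)"
    by (simp add: right_diff_distrib)
  moreover have "norm (a + \<theta>) * D < norm (a + \<theta>) * (norm (a + \<theta>) - norm (b - a))"
    using pos nz by (intro mult_strict_left_mono) auto
  ultimately have "D * norm (a + \<theta>) < (a + \<theta>) \<bullet> (b + \<theta>)"
    unfolding mult.commute[of D] by linarith
  then have "D < (a + \<theta>) \<bullet> (b + \<theta>) / norm (a + \<theta>)"
    using pos by (simp only: pos_less_divide_eq)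
  then show "indicat_real (rejection_zone m n D) (translate n \<theta> x) = 1"
    using pos by (simp add: rejection_zone_def means)
qed

text \<open>Where the two sample means point in opposite directions and the first is long, the test accepts
  although the overall mean is long.\<close>

lemma acceptance_with_long_sum:
  fixes c :: real
  assumes "1 \<le> m" "m < n" "D > 0"
  obtains A :: "(nat \<Rightarrow> real ^ 'd) set" where
    "A \<in> sets (sample_space n)" "emeasure (gaussian_sample n) A \<noteq> 0"
    "\<And>x. x \<in> A \<Longrightarrow> x \<notin> rejection_zone m n D \<and> c < norm (\<Sum>i\<in>{1..n}. x i)"
proof -
  obtain e :: "real ^ 'd" where e: "norm e = 1" using vector_choose_size[of 1] by auto
  \<comment> \<open>\<open>T\<close> serves two ends: \<open>T > 3\<close> forces nonpositive inner
    products between the blocks, and \<open>T - 1 - 3 * real n\<close> exceeds the absolute value of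
    \<open>c\<close>, which bounds the norm of the sum from below.\<close>
  define T where "T = 4 + \<bar>c\<bar> + 3 * real n"
  \<comment> \<open>With unit radius, the component along \<open>e\<close> is at least
    \<open>T - 1\<close> in the first block and between -3 and -1 in the second.\<close>
  define B where "B i = (if i \<le> m then ball (T *\<^sub>R e) 1 else ball (- 2 *\<^sub>R e) 1)" for i
  define A where "A = Pi\<^sub>E {1..n} B"
  interpret product_sigma_finite "\<lambda>_ :: nat. std_gaussian :: (real ^ 'd) measure"
    by (intro product_sigma_finite.intro prob_space_imp_sigma_finite prob_space_std_gaussian)
  have "emeasure (gaussian_sample n) A = (\<Prod>i\<in>{1..n}. emeasure std_gaussian (B i))"
    unfolding gaussian_sample_def A_def by (rule emeasure_PiM) (simp_all add: B_def)
  also have "\<dots> \<noteq> 0"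
    by (auto simp: B_def emeasure_std_gaussian_ball)
  finally have nonnull: "emeasure (gaussian_sample n) A \<noteq> 0" .
  have "T > 3" by (simp add: T_def)
  have "e \<bullet> e = 1" using e by (simp add: norm_eq_1)
  have "x \<notin> rejection_zone m n D \<and> c < norm (\<Sum>i\<in>{1..n}. x i)" if "x \<in> A" for x
  proof
    have small: "\<bar>u \<bullet> w\<bar> \<le> 1" if "norm u \<le> 1" "norm w \<le> 1" for u w :: "real ^ 'd"
      using Cauchy_Schwarz_ineq2[of u w] mult_mono[OF that] by simp
    have dev1: "norm (x i - T *\<^sub>R e) \<le> 1" if "i \<in> {1..m}" for i
      using \<open>x \<in> A\<close> that assms
      by (auto simp: A_def B_def PiE_iff dist_norm norm_minus_commute dest!: bspec[of _ _ i] intro: less_imp_le)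
    have dev2: "norm (x i + 2 *\<^sub>R e) \<le> 1" if "i \<in> {m+1..n}" for i
      using \<open>x \<in> A\<close> that assms
      by (auto simp: A_def B_def PiE_iff dist_norm norm_minus_commute[of "- _"] dest!: bspec[of _ _ i] intro: less_imp_le)
    have "x i \<bullet> x j \<le> 0" if i: "i \<in> {1..m}" and j: "j \<in> {m+1..n}" for i j
    proof -
      \<comment> \<open>Deviations from the centres, both of norm at most 1; expanding the inner
        product bounds it by \<open>3 - T\<close>.\<close>
      define u w where "u = x i - T *\<^sub>R e" and "w = x j + 2 *\<^sub>R e"
      have "x i \<bullet> x j = (T *\<^sub>R e + u) \<bullet> (w - 2 *\<^sub>R e)" by (simp add: u_def w_def)
      also have "\<dots> = T * (e \<bullet> w) - 2 * T - 2 * (u \<bullet> e) + u \<bullet> w"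
        using \<open>e \<bullet> e = 1\<close> by (simp add: inner_add inner_diff algebra_simps)
      also have "\<dots> \<le> T * 1 - 2 * T + 2 * 1 + 1"
      proof -
        have "norm u \<le> 1" "norm w \<le> 1" using dev1[OF i] dev2[OF j] by (simp_all add: u_def w_def)
        then have "T * (e \<bullet> w) \<le> T * 1" "- 1 \<le> u \<bullet> e" "u \<bullet> w \<le> 1"
          using small[of e w] small[of u e] small[of u w] e \<open>T > 3\<close> by (auto simp: abs_le_iff)
        then show ?thesis by linarith
      qed
      also have "\<dots> \<le> 0" using \<open>T > 3\<close> by simp
      finally show ?thesis .
    qed
    then have "(\<Sum>i\<in>{1..m}. x i) \<bullet> (\<Sum>i\<in>{m+1..n}. x i) \<le> 0"
      unfolding inner_sum_left inner_sum_right by (intro sum_nonpos)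
    then have "first_mean m x \<bullet> second_mean m n x \<le> 0"
      by (simp add: first_mean_def second_mean_def mult_nonneg_nonpos divide_nonpos_nonneg)
    then have "first_mean m x \<bullet> second_mean m n x / norm (first_mean m x) \<le> 0"
      by (simp add: divide_nonpos_nonneg)
    then show "x \<notin> rejection_zone m n D"
      using \<open>D > 0\<close> by (auto simp: rejection_zone_def)
    have 1: "T - 1 \<le> e \<bullet> x i" if "i \<in> {1..m}" for i
      using small[of e "x i - T *\<^sub>R e"] dev1[OF that] e \<open>e \<bullet> e = 1\<close> by (simp add: inner_diff)
    have 2: "- 3 \<le> e \<bullet> x i" if "i \<in> {m+1..n}" for i
      using small[of e "x i + 2 *\<^sub>R e"] dev2[OF that] e \<open>e \<bullet> e = 1\<close> by (simp add: inner_add)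
    have "\<bar>c\<bar> < T - 1 - 3 * real n" by (simp add: T_def)
    also have "\<dots> \<le> real m * (T - 1) - 3 * real (n - m)"
    proof -
      have "T - 1 \<le> real m * (T - 1)"
        using assms \<open>T > 3\<close> mult_right_mono[of 1 "real m" "T - 1"] by simp
      moreover have "3 * real (n - m) \<le> 3 * real n" by simp
      ultimately show ?thesis by (rule diff_mono)
    qed
    also have "\<dots> \<le> (\<Sum>i\<in>{1..m}. e \<bullet> x i) + (\<Sum>i\<in>{m+1..n}. e \<bullet> x i)"
      using sum_bounded_below[of "{1..m}" "T - 1" "\<lambda>i. e \<bullet> x i", OF 1]
        sum_bounded_below[of "{m+1..n}" "- 3" "\<lambda>i. e \<bullet> x i", OF 2] by simp
    also have "\<dots> = e \<bullet> (\<Sum>i\<in>{1..n}. x i)"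
      using assms sum.ub_add_nat[of 1 m "\<lambda>i. e \<bullet> x i" "n - m"] by (simp add: inner_sum_right)
    also have "\<dots> \<le> norm (\<Sum>i\<in>{1..n}. x i)"
      using norm_cauchy_schwarz[of e "\<Sum>i\<in>{1..n}. x i"] e by simp
    finally show "c < norm (\<Sum>i\<in>{1..n}. x i)" by linarith
  qed
  moreover have "A \<in> sets (sample_space n)"
    unfolding A_def sample_space_def by (intro sets_PiM_I_finite) (auto simp: B_def)
  ultimately show ?thesis using nonnull that by blast
qed

section \<open>Regularity and inadmissibility of the given test\<close>

lemma regular_testsI:
  assumes "\<phi> \<in> tests (sample_space n)" "test_power (gaussian_law n) \<phi> 0 = \<alpha>"
    and "\<And>x. \<forall>\<^sub>F \<theta> in at_infinity. \<phi> (translate n \<theta> x) = 1"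
  shows "\<phi> \<in> regular_tests (sample_space n) (gaussian_law n) \<alpha>"
  using assms continuous_vanishing_type_II_error[of \<phi> n] by (simp add: regular_tests_def level_tests_def)

theorem theorem4:
  fixes M :: "'w measure" and U :: "nat \<Rightarrow> 'w \<Rightarrow> real ^ 'd"
    and m n :: nat and \<alpha> D :: real
  assumes "1 \<le> m" and "m < n" and "0 < \<alpha>" and "\<alpha> < 1"
    and "prob_space M"
    and "prob_space.indep_vars M (\<lambda>_. borel) U {1..n}"
    and "\<And>i. i \<in> {1..n} \<Longrightarrow> distributed M lborel (U i) (\<lambda>x. ennreal (std_gaussian_density x))"
    and "D > 0"
    and "measure (shifted_law M U n 0) (rejection_zone m n D) = \<alpha>"
  shows "indicat_real (rejection_zone m n D) \<in>
    regular_tests (sample_space n) (shifted_law M U n) \<alpha> -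
    admissible_tests (sample_space n) (shifted_law M U n) \<alpha>"
proof
  let ?R = "rejection_zone m n D :: (nat \<Rightarrow> real ^ 'd) set"
  have law: "shifted_law M U n = gaussian_law n"
    using assms by (intro shifted_law_eq_gaussian_law) auto
  have R: "indicat_real ?R \<in> tests (sample_space n)"
    using \<open>m < n\<close> by (rule rejection_zone_in_tests)
  have "?R \<subseteq> space (gaussian_law n 0)"
    by (auto simp: rejection_zone_def gaussian_law_def)
  then have level: "test_power (gaussian_law n) (indicat_real ?R) 0 = \<alpha>"
    using assms(9) by (simp add: test_power_def law Int_absorb2)
  show "indicat_real ?R \<in> regular_tests (sample_space n) (shifted_law M U n) \<alpha>"
    unfolding law using R level eventually_rejection_zone[OF assms(1,2)] by (rule regular_testsI)
  obtain c \<gamma> where c: "0 \<le> c" and \<gamma>: "0 \<le> \<gamma>" "\<gamma> \<le> 1"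
    and level': "test_power (gaussian_law n) (threshold_test n c \<gamma> :: (nat \<Rightarrow> real ^ 'd) \<Rightarrow> real) 0 = \<alpha>"
    using assms(3,4) by (rule threshold_test_level)
  let ?T = "threshold_test n c \<gamma> :: (nat \<Rightarrow> real ^ 'd) \<Rightarrow> real"
  have T: "?T \<in> regular_tests (sample_space n) (gaussian_law n) \<alpha>"
    using assms(1,2)
    by (intro regular_testsI threshold_test_in_tests \<gamma> level' eventually_threshold_test) linarith
  obtain A :: "(nat \<Rightarrow> real ^ 'd) set" where A: "A \<in> sets (sample_space n)"
    "emeasure (gaussian_sample n) A \<noteq> 0"
    "\<And>x. x \<in> A \<Longrightarrow> x \<notin> ?R \<and> c < norm (\<Sum>i\<in>{1..n}. x i)"
    using acceptance_with_long_sum[OF assms(1,2,8)] by blast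
  have better: "test_power (gaussian_law n) (indicat_real ?R) \<theta> < test_power (gaussian_law n) ?T \<theta>"
    if "\<theta> \<noteq> 0" for \<theta>
  proof (rule threshold_test_more_powerful[OF R rotation_invariant_rejection_zone[OF \<open>m < n\<close>] c \<gamma> _ A(1,2) _ that])
    show "test_power (gaussian_law n) ?T 0 = test_power (gaussian_law n) (indicat_real ?R) 0"
      unfolding level level' ..
    show "indicat_real ?R x = 0 \<and> c < norm (\<Sum>i\<in>{1..n}. x i)" if "x \<in> A" for x
      using A(3)[OF that] by simp
  qed
  \<comment> \<open>The dimension is at least 1, so an alternative exists; there the strict
    inequality contradicts the equality of powers that admissibility would force.\<close>
  obtain \<theta> :: "real ^ 'd" where "norm \<theta> = 1" using vector_choose_size[of 1] by auto
  then have "\<theta> \<noteq> 0" by auto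
  show "indicat_real ?R \<notin> admissible_tests (sample_space n) (shifted_law M U n) \<alpha>"
  proof
    assume "indicat_real ?R \<in> admissible_tests (sample_space n) (shifted_law M U n) \<alpha>"
    then have "\<forall>\<theta>. \<theta> \<noteq> 0 \<longrightarrow> test_power (gaussian_law n) (indicat_real ?R) \<theta> = test_power (gaussian_law n) ?T \<theta>"
      unfolding law admissible_tests_def using T better less_imp_le by blast
    then show False using better[OF \<open>\<theta> \<noteq> 0\<close>] \<open>\<theta> \<noteq> 0\<close> by simp
  qed
qed

end
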